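(* Let $T$ and $T'$ be trees on $n$ vertices. Then $T'$ can be obtained (up to isomorphism) from $T$ by applying a finite sequence of Stretching and Expanding operations.
   Context: All graphs are finite, undirected and simple. For a vertex $u$ of a graph, $N(u)$ is its set of neighbors and $N[u]=\{u\}\cup N(u)$. A leaf is a vertex of degree one. Stretching a tree $T$ at a leaf $a$: let $T$ be a tree with $n\geq 3$ vertices and let $a$ be a leaf of $T$. Let $T'$ be obtained from $T$ by deleting a leaf $b$ of $T$ with $b\neq a$ and adding a new vertex joined only to $a$. Then $T'$ is said to be obtained by Stretching $T$ at leaf $a$ (any choice of $b$ is allowed). Expanding a tree $T$ at a vertex $u$: let $2\leq d\leq n-2$ and let $T$ be a tree with $n\geq 4$ vertices. Let $u\in V(T)$ with $N(u)=\{z_0,z_1,\dots,z_{d-1}\}$ be such that $z_i$ is a leaf of $T$ for each $1\le i\le d-1$ and $z_0$ is not a leaf. Let $T'$ be obtained from $T$ by deleting a leaf $b$ of $T$ with $b\notin N[u]$ and adding a new vertex joined only to $u$. Then $T'$ is said to be obtained by Expanding $T$ at vertex $u$ (any choice of $b$ is allowed). The sequence of operations may be empty. *)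

theory Defs
  imports "Graph_Theory.Pair_Digraph" "Graph_Theory.Digraph_Isomorphism"
begin

text \<open>
  A finite simple graph is a \<open>pair_graph\<close>, i.e. a finite loop-free symmetric digraph without
  parallel arcs, in which an undirected edge is represented by its two arcs.
\<close>

definition nbhd :: "'a pair_pre_digraph \<Rightarrow> 'a \<Rightarrow> 'a set" where
  "nbhd G u = {v. (u, v) \<in> parcs G}"

definition closed_nbhd :: "'a pair_pre_digraph \<Rightarrow> 'a \<Rightarrow> 'a set" where
  "closed_nbhd G u = insert u (nbhd G u)"

definition leaf :: "'a pair_pre_digraph \<Rightarrow> 'a \<Rightarrow> bool" where
  "leaf G u \<longleftrightarrow> u \<in> pverts G \<and> card (nbhd G u) = 1"

text \<open>
  The predicate \<open>Digraph_Component.tree\<close> is unsuitable here: for it, the two arcs of a single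
  undirected edge already form a (directed) cycle. The cycles of an undirected simple graph are
  the directed cycles of length at least 3 of the symmetric digraph. A connected graph is
  nonempty.
\<close>

definition undirected_tree :: "'a pair_pre_digraph \<Rightarrow> bool" where
  "undirected_tree G \<longleftrightarrow> pair_graph G \<and> Digraph_Component.connected (with_proj G) \<and>
     \<not> (\<exists>p. pre_digraph.cycle (with_proj G) p \<and> 3 \<le> length p)"

definition delete_vertex :: "'a pair_pre_digraph \<Rightarrow> 'a \<Rightarrow> 'a pair_pre_digraph" where
  "delete_vertex G b = \<lparr>pverts = pverts G - {b}, parcs = {e \<in> parcs G. fst e \<noteq> b \<and> snd e \<noteq> b}\<rparr>"

definition attach_vertex :: "'a pair_pre_digraph \<Rightarrow> 'a \<Rightarrow> 'a \<Rightarrow> 'a pair_pre_digraph" where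
  "attach_vertex G v w = \<lparr>pverts = insert w (pverts G), parcs = parcs G \<union> {(v, w), (w, v)}\<rparr>"

text \<open>
  In both operations the added vertex \<open>w\<close> is new to the graph left after the deletion of \<open>b\<close>.
  In particular the name \<open>b\<close> may be used again, which does not affect the isomorphism type of the
  result and makes the operations available when the vertices exhaust a finite type.
\<close>

definition stretching_at :: "'a pair_pre_digraph \<Rightarrow> 'a \<Rightarrow> 'a pair_pre_digraph \<Rightarrow> bool" where
  "stretching_at T a T' \<longleftrightarrow>
     undirected_tree T \<and> 3 \<le> card (pverts T) \<and> leaf T a \<and>
     (\<exists>b w. leaf T b \<and> b \<noteq> a \<and> w \<notin> pverts (delete_vertex T b) \<and>
        T' = attach_vertex (delete_vertex T b) a w)"

definition expanding_at :: "'a pair_pre_digraph \<Rightarrow> 'a \<Rightarrow> 'a pair_pre_digraph \<Rightarrow> bool" where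
  "expanding_at T u T' \<longleftrightarrow>
     undirected_tree T \<and> 4 \<le> card (pverts T) \<and> u \<in> pverts T \<and>
     (\<exists>d (z :: nat \<Rightarrow> 'a). 2 \<le> d \<and> d \<le> card (pverts T) - 2 \<and>
        inj_on z {..<d} \<and> nbhd T u = z ` {..<d} \<and>
        (\<forall>i. 1 \<le> i \<and> i \<le> d - 1 \<longrightarrow> leaf T (z i)) \<and> \<not> leaf T (z 0)) \<and>
     (\<exists>b w. leaf T b \<and> b \<notin> closed_nbhd T u \<and> w \<notin> pverts (delete_vertex T b) \<and>
        T' = attach_vertex (delete_vertex T b) u w)"

definition stretch_or_expand :: "'a pair_pre_digraph \<Rightarrow> 'a pair_pre_digraph \<Rightarrow> bool" where
  "stretch_or_expand T T' \<longleftrightarrow> (\<exists>a. stretching_at T a T') \<or> (\<exists>u. expanding_at T u T')"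

end

theory Submission
  imports Defs
begin

text \<open>
  Two trees on one vertex are isomorphic, so let \<open>n \<ge> 2\<close>. The target tree \<open>T'\<close> is built inside \<open>T\<close>, and the vertices of \<open>T\<close> serve as the supply. Root \<open>T'\<close> at
  a leaf \<open>r\<close> with neighbor \<open>s\<close>, and let \<open>a\<close> be a leaf of \<open>T\<close> with neighbor \<open>c\<close>. The edge from \<open>c\<close> to \<open>a\<close> is a
  copy of the edge from \<open>r\<close> to \<open>s\<close>, and all other vertices of \<open>T\<close> are unused and hang from \<open>c\<close>, the
  copy of the root. Now the remaining vertices of \<open>T'\<close> are added to the copy in order of their
  distance from \<open>r\<close>, each time at the expense of an unused leaf.

  Each addition is one of the two operations. The first child of a vertex is added to a leaf, which is a
  stretching. When a further child of \<open>u\<close> is added, the earlier children of \<open>u\<close> are still leaves because of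
  the order, and the parent of \<open>u\<close> is not a leaf: it has a parent itself, or it is the root, from which
  the nonempty unused part hangs. So this is an expanding (\<open>grow_copy\<close>). Since both trees have \<open>n\<close>
  vertices, the unused part is exhausted exactly when the copy is complete (\<open>complete_copy\<close>,
  \<open>full_copy_iso\<close>).

  That the unused part contains a leaf, and that each step yields a tree again, is seen from the
  distance function of a rooted tree, which characterizes trees (\<open>levelling_imp_tree\<close>,
  \<open>tree_levelling\<close>).
\<close>

section \<open>Trees and level functions\<close>

lemma pair_graph_iff:
  "pair_graph G \<longleftrightarrow> finite (pverts G) \<and> parcs G \<subseteq> pverts G \<times> pverts G \<and> sym (parcs G) \<and>
     (\<forall>v. (v, v) \<notin> parcs G)"
  (is "_ \<longleftrightarrow> ?R")
proof
  assume "pair_graph G"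
  then interpret pair_graph G .
  show ?R
    using pair_finite_verts in_arcsD1 in_arcsD2 arcs_symmetric no_loops' unfolding sym_def by fast
next
  assume R: ?R
  then have "finite (parcs G)"
    by (meson finite_SigmaI finite_subset)
  then show "pair_graph G"
    using R by unfold_locales (auto simp: symmetric_def)
qed

text \<open>
  A levelling is the distance function of a tree rooted at \<open>r\<close>, described locally: adjacent vertices lie on
  consecutive levels, and every vertex other than the root has exactly one neighbor below it, its
  parent. Among finite simple graphs such a function exists precisely on trees, and unlike connectedness and acyclicity it is easy
  to update when a leaf is removed or added.
\<close>

definition levelling :: "'a pair_pre_digraph \<Rightarrow> 'a \<Rightarrow> ('a \<Rightarrow> nat) \<Rightarrow> bool" where
  "levelling G r d \<longleftrightarrow> r \<in> pverts G \<and> d r = 0 \<and>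
     (\<forall>u v. (u, v) \<in> parcs G \<longrightarrow> d v = Suc (d u) \<or> d u = Suc (d v)) \<and>
     (\<forall>v \<in> pverts G - {r}. \<exists>!p. (v, p) \<in> parcs G \<and> d v = Suc (d p))"

lemma levelling_lower_unique:
  assumes "pair_graph G" "levelling G r d" "(v, p) \<in> parcs G" "(v, q) \<in> parcs G" "d p \<le> d v" "d q \<le> d v"
  shows "p = q"
proof -
  have below: "d v = Suc (d x)" if "(v, x) \<in> parcs G" "d x \<le> d v" for x
    using assms(2) that unfolding levelling_def by force
  have "v \<noteq> r"
    using below[OF assms(3,5)] assms(2) by (auto simp: levelling_def)
  moreover have "v \<in> pverts G"
    using assms(1,3) by (auto simp: pair_graph_iff)
  ultimately have "\<exists>!x. (v, x) \<in> parcs G \<and> d v = Suc (d x)"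
    using assms(2) by (simp add: levelling_def)
  then show ?thesis
    using below[OF assms(3,5)] below[OF assms(4,6)] assms(3,4) by blast
qed

lemma levelling_reachable_root:
  assumes "levelling G r d" "pair_graph G" "v \<in> pverts G"
  shows "reachable (with_proj G) v r"
  using assms(3)
proof (induction "d v" arbitrary: v rule: less_induct)
  case less
  interpret pair_graph G by fact
  show ?case
  proof (cases "v = r")
    case False
    then obtain p where p: "(v, p) \<in> parcs G" "d v = Suc (d p)"
      using assms(1) less.prems unfolding levelling_def by blast
    then have "reachable (with_proj G) p r"
      using less in_arcsD2 by auto
    with p show ?thesis
      using adj_reachable_trans by simp
  qed (use less in simp)
qed

lemma pcas_consecutive:
  "pcas u p v \<Longrightarrow> Suc i < length p \<Longrightarrow> snd (p ! i) = fst (p ! Suc i)"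
proof (induction p arbitrary: u i)
  case (Cons e p)
  then show ?case by (cases i; cases p) auto
qed simp

lemma pcas_ends:
  "pcas u p v \<Longrightarrow> p \<noteq> [] \<Longrightarrow> fst (hd p) = u \<and> snd (last p) = v"
  by (induction p arbitrary: u) (auto split: if_splits)

lemma pawalk_verts_pcas: "pcas u p v \<Longrightarrow> pawalk_verts u p = u # map snd p"
  by (induction p arbitrary: u) auto

text \<open>
  At a vertex of highest level on a cycle, both neighbors along the cycle lie one level below, so they
  are the same parent. On a cycle of length at least 3 these two neighbors are distinct.
\<close>

lemma levelling_no_cycle:
  assumes G: "pair_graph G" and lev: "levelling G r d"
    and cyc: "pre_digraph.cycle (with_proj G) p"
  shows "length p < 3"
proof (rule ccontr)
  assume "\<not> length p < 3"
  define k where "k = length p"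
  have k: "3 \<le> k"
    using \<open>\<not> length p < 3\<close> by (simp add: k_def)
  interpret pair_graph G by fact
  obtain u where "awalk u p u" "distinct (tl (pawalk_verts u p))" "p \<noteq> []"
    using cyc unfolding cycle_def by blast
  then have arcs: "set p \<subseteq> parcs G" and cas: "pcas u p u" and dist: "distinct (map snd p)"
    unfolding awalk_def by (auto simp: pawalk_verts_pcas)
  \<comment> \<open>the vertices of the cycle as a periodic sequence, so that the base point needs no special treatment\<close>
  define g where "g i = snd (p ! (i mod k))" for i
  have step: "(g i, g (Suc i)) \<in> parcs G" for i
  proof -
    have "g i = fst (p ! (Suc i mod k))"
    proof (cases "Suc (i mod k) < k")
      case True
      then have "Suc i mod k = Suc (i mod k)"
        by (simp add: mod_Suc)
      then show ?thesis
        using pcas_consecutive[OF cas] True unfolding g_def k_def by simp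
    next
      case False
      moreover have "i mod k < k"
        using k by simp
      ultimately have "Suc (i mod k) = k"
        by linarith
      then have "i mod k = k - 1" "Suc i mod k = 0"
        by (simp_all add: mod_Suc)
      then show ?thesis
        using pcas_ends[OF cas \<open>p \<noteq> []\<close>] \<open>p \<noteq> []\<close>
        by (simp add: g_def k_def last_conv_nth hd_conv_nth)
    qed
    then have "(g i, g (Suc i)) = p ! (Suc i mod k)"
      by (simp add: g_def prod_eq_iff)
    moreover have "Suc i mod k < length p"
      using \<open>p \<noteq> []\<close> by (simp add: k_def)
    ultimately show ?thesis
      using arcs nth_mem by fastforce
  qed
  have "finite (range g)"
    by (rule finite_subset[of _ "pverts G"]) (use step in_arcsD1 pair_finite_verts in blast)+
  then have fin: "finite (range (\<lambda>i. d (g i)))"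
    by (metis finite_imageI image_image)
  define m where "m = Max (range (\<lambda>i. d (g i)))"
  obtain i where i: "d (g i) = m"
    using Max_in[OF fin] unfolding m_def by auto
  have max: "d (g j) \<le> d (g i)" for j
    using Max_ge[OF fin] i unfolding m_def by auto
  have "g (i + k) = g i"
    by (simp add: g_def)
  then have "(g (i + (k - 1)), g i) \<in> parcs G"
    using step[of "i + (k - 1)"] k by simp
  then have "(g i, g (i + (k - 1))) \<in> parcs G"
    by (rule arcs_symmetric)
  then have "g (i + (k - 1)) = g (Suc i)"
    by (rule levelling_lower_unique[OF G lev _ step max max])
  moreover have "map snd p ! (j mod k) = g j" for j
    using \<open>p \<noteq> []\<close> by (simp add: g_def k_def)
  ultimately have "map snd p ! ((i + (k - 1)) mod k) = map snd p ! (Suc i mod k)"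
    by simp
  moreover have "j mod k < length (map snd p)" for j
    using \<open>p \<noteq> []\<close> by (simp add: k_def)
  ultimately have "(i + (k - 1)) mod k = Suc i mod k"
    using nth_eq_iff_index_eq[OF dist] by blast
  \<comment> \<open>the two positions are \<open>k - 2\<close> apart\<close>
  then have "k dvd (k - 2)"
    using k mod_eq_dvd_iff_nat[of "Suc i" "i + (k - 1)" k] by (simp add: numeral_2_eq_2)
  then have "k \<le> k - 2"
    using k by (intro dvd_imp_le) simp_all
  then show False
    using k by linarith
qed

lemma levelling_imp_tree:
  assumes "pair_graph G" "levelling G r d"
  shows "undirected_tree G"
proof -
  interpret pair_graph G by fact
  have "Digraph_Component.connected (with_proj G)"
  proof (rule connectedI)
    show "pverts G \<noteq> {}"
      using assms(2) by (auto simp: levelling_def)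
    fix u v assume "u \<in> pverts G" "v \<in> pverts G"
    then have "reachable (with_proj G) u r" "reachable (with_proj G) r v"
      using levelling_reachable_root[OF assms(2,1)] by (auto intro: symmetric_reachable')
    then have "reachable (with_proj G) u v"
      by (rule reachable_trans)
    then show "reachable (with_proj (mk_symmetric (with_proj G))) u v"
      by (rule reachable_mk_symmetricI)
  qed
  then show ?thesis
    using assms(1) levelling_no_cycle[OF assms] unfolding undirected_tree_def by fastforce
qed

lemma pair_graph_attach_vertex:
  assumes "pair_graph G" "a \<in> pverts G" "w \<notin> pverts G"
  shows "pair_graph (attach_vertex G a w)"
  using assms unfolding pair_graph_iff attach_vertex_def sym_def by auto

lemma levelling_attach_vertex:
  assumes G: "pair_graph G" and lev: "levelling G r d" and a: "a \<in> pverts G" and w: "w \<notin> pverts G"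
  shows "levelling (attach_vertex G a w) r (d(w := Suc (d a)))"
proof -
  have not_w: "u \<noteq> w \<and> v \<noteq> w" if "(u, v) \<in> parcs G" for u v
    using that w G unfolding pair_graph_iff by auto
  have "a \<noteq> w" "r \<noteq> w"
    using a w lev by (auto simp: levelling_def)
  have "\<exists>!p. (v, p) \<in> parcs G \<union> {(a, w), (w, a)} \<and> (d(w := Suc (d a))) v = Suc ((d(w := Suc (d a))) p)"
    if v: "v \<in> insert w (pverts G) - {r}" for v
  proof (cases "v = w")
    case True
    then show ?thesis
      using \<open>a \<noteq> w\<close> not_w by (intro ex1I[of _ a]) auto
  next
    case False
    then obtain p where p: "(v, p) \<in> parcs G" "d v = Suc (d p)"
      "\<And>q. (v, q) \<in> parcs G \<Longrightarrow> d v = Suc (d q) \<Longrightarrow> q = p"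
      using lev v unfolding levelling_def by blast
    show ?thesis
    proof (rule ex1I[of _ p])
      show "(v, p) \<in> parcs G \<union> {(a, w), (w, a)} \<and> (d(w := Suc (d a))) v = Suc ((d(w := Suc (d a))) p)"
        using p(1,2) not_w False by simp
      fix q
      assume q: "(v, q) \<in> parcs G \<union> {(a, w), (w, a)} \<and> (d(w := Suc (d a))) v = Suc ((d(w := Suc (d a))) q)"
      then have "q \<noteq> w"
        using False not_w by auto
      then show "q = p"
        using p(3) q False by simp
    qed
  qed
  then show ?thesis
    using lev not_w \<open>r \<noteq> w\<close> \<open>a \<noteq> w\<close> unfolding levelling_def attach_vertex_def by auto
qed

definition induced :: "'a pair_pre_digraph \<Rightarrow> 'a set \<Rightarrow> 'a pair_pre_digraph" where
  "induced G W = \<lparr>pverts = W, parcs = parcs G \<inter> W \<times> W\<rparr>"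

lemma pair_graph_induced:
  assumes "pair_graph G" "W \<subseteq> pverts G"
  shows "pair_graph (induced G W)"
  using assms unfolding pair_graph_iff induced_def sym_def by (auto intro: finite_subset)

text \<open>
  Two edges from \<open>x\<close> into a connected part \<open>W\<close> close up, through a path inside \<open>W\<close>, to a cycle of length
  at least 3. This is the only place where acyclicity is used.
\<close>

lemma tree_unique_edge_to_connected:
  assumes T: "undirected_tree G"
    and W: "pair_graph (induced G W)" "Digraph_Component.connected (with_proj (induced G W))"
    and u: "u \<in> W" "(u, x) \<in> parcs G" and v: "v \<in> W" "(v, x) \<in> parcs G" and x: "x \<notin> W"
  shows "u = v"
proof (rule ccontr)
  assume "u \<noteq> v"
  interpret pair_graph G
    using T by (simp add: undirected_tree_def)
  interpret H: pair_graph "induced G W"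
    by (rule W(1))
  have "strongly_connected (with_proj (induced G W))"
    using W(2) H.symmetric_connected_imp_strongly_connected H.sym_arcs by auto
  then have "reachable (with_proj (induced G W)) u v"
    using u v by (auto simp: induced_def)
  then obtain q where "H.apath u q v"
    using H.reachable_apath by auto
  then have q: "H.awalk u q v" "distinct (pawalk_verts u q)"
    unfolding H.apath_def by auto
  have "set (pawalk_verts u q) \<subseteq> W"
    using H.awalk_verts_in_verts q(1) unfolding H.awalk_def by (auto simp: induced_def)
  have "set q \<subseteq> parcs G" "pcas u q v" "q \<noteq> []"
    using q(1) \<open>u \<noteq> v\<close> unfolding H.awalk_def by (auto simp: induced_def)
  have cas: "pcas a (es @ [(v, b)]) b" if "pcas a es v" for a b es
    using that by (induction es arbitrary: a) auto
  have pv: "pawalk_verts a (es @ [(v, b)]) = pawalk_verts a es @ [b]" if "pcas a es v" for a b es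
    using that by (induction es arbitrary: a) auto
  let ?c = "(x, u) # q @ [(v, x)]"
  have "awalk x ?c x"
    using u v \<open>set q \<subseteq> parcs G\<close> cas[OF \<open>pcas u q v\<close>] arcs_symmetric in_arcsD2
    unfolding awalk_def by auto
  moreover have "distinct (tl (pawalk_verts x ?c))"
    using q(2) pv[OF \<open>pcas u q v\<close>] \<open>set (pawalk_verts u q) \<subseteq> W\<close> x by auto
  ultimately have "cycle ?c"
    unfolding cycle_def by auto
  moreover have "3 \<le> length ?c"
    using \<open>q \<noteq> []\<close> by (cases q) auto
  ultimately show False
    using T unfolding undirected_tree_def by blast
qed

lemma connected_edge_out:
  assumes "pair_graph G" "Digraph_Component.connected (with_proj G)"
    and W: "W \<subseteq> pverts G" "W \<noteq> pverts G" "r \<in> W"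
  obtains u x where "u \<in> W" "x \<in> pverts G" "x \<notin> W" "(u, x) \<in> parcs G"
proof -
  interpret pair_graph G by fact
  obtain y where y: "y \<in> pverts G" "y \<notin> W"
    using W by auto
  have "strongly_connected (with_proj G)"
    using assms(2) symmetric_connected_imp_strongly_connected sym_arcs by auto
  then have "reachable (with_proj G) r y"
    using y W unfolding strongly_connected_def by (simp add: subset_iff)
  moreover have "\<exists>u x. u \<in> W \<and> x \<notin> W \<and> (u, x) \<in> parcs G"
    if "reachable (with_proj G) r z" "z \<notin> W" for z
    using that
  proof (induction rule: reachable_induct)
    case base
    then show ?case using W by simp
  next
    case (step a b)
    then show ?case by auto
  qed
  ultimately show ?thesis
    using y that in_arcsD2 by metis
qed

text \<open>
  Take a maximal vertex set \<open>W\<close> containing \<open>r\<close> whose induced subgraph has a levelling. If \<open>W\<close> were not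
  everything, connectedness would give an edge leaving \<open>W\<close>. By acyclicity its outer end \<open>x\<close> has only
  that one neighbor in \<open>W\<close>, so \<open>x\<close> could be placed one level above it.
\<close>

lemma tree_levelling:
  assumes T: "undirected_tree G" and r: "r \<in> pverts G"
  obtains d where "levelling G r d"
proof -
  have G: "pair_graph G" and con: "Digraph_Component.connected (with_proj G)"
    using T by (auto simp: undirected_tree_def)
  interpret pair_graph G by fact
  define \<W> where "\<W> = {W. W \<subseteq> pverts G \<and> (\<exists>d. levelling (induced G W) r d)}"
  have "finite \<W>"
    unfolding \<W>_def using pair_finite_verts by simp
  moreover have "{r} \<in> \<W>"
    using r no_loops' unfolding \<W>_def levelling_def induced_def by (auto intro!: exI[of _ "\<lambda>_. 0"])
  ultimately obtain W where W: "W \<in> \<W>" and max: "\<And>W'. W' \<in> \<W> \<Longrightarrow> W \<subseteq> W' \<Longrightarrow> W' = W"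
    using finite_has_maximal[of \<W>] by auto
  then obtain d where WG: "W \<subseteq> pverts G" and d: "levelling (induced G W) r d"
    unfolding \<W>_def by auto
  have H: "pair_graph (induced G W)"
    using G WG by (rule pair_graph_induced)
  have conW: "Digraph_Component.connected (with_proj (induced G W))"
    using levelling_imp_tree[OF H d] by (simp add: undirected_tree_def)
  have "r \<in> W"
    using d by (simp add: levelling_def induced_def)
  have "W = pverts G"
  proof (rule ccontr)
    assume "W \<noteq> pverts G"
    then obtain u x where ux: "u \<in> W" "x \<in> pverts G" "x \<notin> W" "(u, x) \<in> parcs G"
      using connected_edge_out[OF G con WG _ \<open>r \<in> W\<close>] by metis
    have "(v, x) \<in> parcs G \<longleftrightarrow> v = u" if "v \<in> W" for v
      using tree_unique_edge_to_connected[OF T H conW] ux that by blast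
    moreover from this have "(x, v) \<in> parcs G \<longleftrightarrow> v = u" if "v \<in> W" for v
      using that arcs_symmetric by blast
    moreover have "(x, x) \<notin> parcs G"
      using no_loops' by blast
    ultimately have "induced G (insert x W) = attach_vertex (induced G W) u x"
      using ux(1) unfolding induced_def attach_vertex_def by auto
    moreover have "levelling (attach_vertex (induced G W) u x) r (d(x := Suc (d u)))"
      using levelling_attach_vertex[OF H d] ux by (simp add: induced_def)
    ultimately have "insert x W \<in> \<W>"
      using WG ux unfolding \<W>_def by auto
    then show False
      using max ux by blast
  qed
  moreover have "induced G (pverts G) = G"
    using in_arcsD1 in_arcsD2 by (intro pair_pre_digraph.equality) (auto simp: induced_def)
  ultimately show ?thesis
    using d that by simp
qed

lemma tree_attach_vertex:
  assumes "undirected_tree G" "a \<in> pverts G" "w \<notin> pverts G"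
  shows "undirected_tree (attach_vertex G a w)"
proof -
  have "pair_graph G"
    using assms by (simp add: undirected_tree_def)
  moreover obtain d where "levelling G a d"
    using tree_levelling assms by metis
  ultimately show ?thesis
    using assms levelling_imp_tree levelling_attach_vertex pair_graph_attach_vertex by metis
qed

lemma leafE:
  assumes "leaf G b"
  obtains c where "nbhd G b = {c}"
  using assms unfolding leaf_def by (metis card_1_singletonE)

text \<open>
  Rooting the tree at a vertex other than the deleted leaf \<open>b\<close>, the only neighbor of \<open>b\<close> is its parent. So
  \<open>b\<close> is nobody's parent, and the levelling survives its deletion.
\<close>

lemma tree_delete_leaf:
  assumes T: "undirected_tree G" and b: "leaf G b" and a: "a \<in> pverts G" "a \<noteq> b"
  shows "undirected_tree (delete_vertex G b)"
proof -
  have G: "pair_graph G"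
    using T by (simp add: undirected_tree_def)
  obtain d where d: "levelling G a d"
    using tree_levelling T a by metis
  obtain c where c: "nbhd G b = {c}"
    using leafE[OF b] .
  have only_c: "q = c" if "(b, q) \<in> parcs G" for q
    using that c by (auto simp: nbhd_def)
  have G': "pair_graph (delete_vertex G b)"
    using G unfolding pair_graph_iff delete_vertex_def sym_def by auto
  have "d b = Suc (d c)"
    using d b a only_c unfolding levelling_def leaf_def by blast
  have "\<exists>!p. (v, p) \<in> parcs G \<and> v \<noteq> b \<and> p \<noteq> b \<and> d v = Suc (d p)"
    if v: "v \<in> pverts G" "v \<noteq> b" "v \<noteq> a" for v
  proof -
    obtain p where p: "(v, p) \<in> parcs G" "d v = Suc (d p)"
      "\<And>q. (v, q) \<in> parcs G \<Longrightarrow> d v = Suc (d q) \<Longrightarrow> q = p"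
      using d v unfolding levelling_def by blast
    have "p \<noteq> b"
    proof
      assume "p = b"
      then have "v = c"
        using p G only_c unfolding pair_graph_iff sym_def by blast
      then have "d c = Suc (d b)"
        using p(2) \<open>p = b\<close> by metis
      then show False
        using \<open>d b = Suc (d c)\<close> by linarith
    qed
    then show ?thesis
      using p v(2) by blast
  qed
  then have "\<forall>v \<in> pverts (delete_vertex G b) - {a}. \<exists>!p. (v, p) \<in> parcs (delete_vertex G b) \<and> d v = Suc (d p)"
    by (simp add: delete_vertex_def)
  moreover have "\<forall>u v. (u, v) \<in> parcs (delete_vertex G b) \<longrightarrow> d v = Suc (d u) \<or> d u = Suc (d v)"
    using d by (simp add: levelling_def delete_vertex_def)
  moreover have "a \<in> pverts (delete_vertex G b)" "d a = 0"
    using d a by (simp_all add: levelling_def delete_vertex_def)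
  ultimately have "levelling (delete_vertex G b) a d"
    by (simp add: levelling_def)
  then show ?thesis
    using levelling_imp_tree[OF G'] by simp
qed

text \<open>
  A set \<open>R\<close> that communicates with the rest of the tree only through the root contains a leaf: at a vertex
  of highest level in \<open>R\<close> no neighbor is higher, so the parent is the only neighbor.
\<close>

lemma leaf_in_branch:
  assumes G: "pair_graph G" and d: "levelling G r d"
    and R: "R \<subseteq> pverts G" "R \<noteq> {}" "r \<notin> R"
    and closed: "\<And>v. v \<in> R \<Longrightarrow> nbhd G v \<subseteq> insert r R"
  obtains b where "b \<in> R" "leaf G b"
proof -
  have "finite R"
    using G R finite_subset unfolding pair_graph_iff by blast
  then obtain b where b: "b \<in> R" "\<And>v. v \<in> R \<Longrightarrow> d v \<le> d b"
    using obtains_MAX[OF \<open>finite R\<close> \<open>R \<noteq> {}\<close>, of d] Max_ge \<open>finite R\<close> by (metis finite_imageI image_eqI)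
  then obtain p where p: "(b, p) \<in> parcs G" "d b = Suc (d p)"
    using d R unfolding levelling_def by blast
  have "q = p" if q: "(b, q) \<in> parcs G" for q
  proof (rule levelling_lower_unique[OF G d q p(1)])
    have "q \<in> R \<or> q = r"
      using closed b q by (auto simp: nbhd_def)
    then show "d q \<le> d b"
      using b d by (auto simp: levelling_def)
  qed (use p in simp)
  then have "nbhd G b = {p}"
    using p(1) unfolding nbhd_def by blast
  then show ?thesis
    using b(1) R(1) that by (auto simp: leaf_def)
qed

text \<open>
  The parent of a vertex of lowest level in \<open>R\<close> is outside \<open>R\<close>, so it can only be the root.
\<close>

lemma branch_meets_root:
  assumes d: "levelling G r d"
    and R: "R \<subseteq> pverts G" "R \<noteq> {}" "r \<notin> R"
    and closed: "\<And>v. v \<in> R \<Longrightarrow> nbhd G v \<subseteq> insert r R"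
  obtains v where "v \<in> R" "(v, r) \<in> parcs G"
proof -
  obtain v where v: "v \<in> R" "\<And>x. x \<in> R \<Longrightarrow> d v \<le> d x"
    using \<open>R \<noteq> {}\<close> exists_least_iff[of "\<lambda>n. \<exists>v \<in> R. d v = n"] by (metis ex_in_conv linorder_not_less)
  then obtain p where p: "(v, p) \<in> parcs G" "d v = Suc (d p)"
    using d R unfolding levelling_def by blast
  then have "p \<notin> R"
    using v(2)[of p] by auto
  then have "p = r"
    using closed[OF v(1)] p(1) by (auto simp: nbhd_def)
  then show ?thesis
    using v(1) p(1) that by blast
qed

lemma tree_has_leaf:
  assumes T: "undirected_tree G" and card: "2 \<le> card (pverts G)"
  obtains a where "leaf G a"
proof -
  have G: "pair_graph G"
    using T by (simp add: undirected_tree_def)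
  obtain r where r: "r \<in> pverts G"
    using card by fastforce
  obtain d where d: "levelling G r d"
    using tree_levelling[OF T r] .
  have "pverts G \<noteq> {r}"
    using card by auto
  then have "pverts G - {r} \<noteq> {}"
    using r by blast
  moreover have "nbhd G v \<subseteq> insert r (pverts G - {r})" for v
    using G by (auto simp: nbhd_def pair_graph_iff)
  ultimately show ?thesis
    using leaf_in_branch[OF G d, of "pverts G - {r}"] that by blast
qed

section \<open>Partial copies of the target tree\<close>

lemma not_leafI:
  assumes "(v, x) \<in> parcs G" "(v, y) \<in> parcs G" "x \<noteq> y"
  shows "\<not> leaf G v"
proof
  assume "leaf G v"
  then obtain c where "nbhd G v = {c}"
    by (rule leafE)
  then have "x \<in> {c}" "y \<in> {c}"
    using assms(1,2) unfolding nbhd_def by blast+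
  then show False
    using assms(3) by simp
qed

text \<open>
  The invariant of the construction: \<open>f\<close> embeds the part \<open>H\<close> of the target tree \<open>T\<close> as an induced
  subgraph of the current tree \<open>S\<close>, and the vertices of \<open>S\<close> that are not yet used hang only from the image of
  the root \<open>r\<close>. The last condition makes degrees in the copy agree with degrees in \<open>H\<close>, except at
  the root.
\<close>

definition partial_copy ::
  "'b pair_pre_digraph \<Rightarrow> 'b \<Rightarrow> 'b set \<Rightarrow> 'a pair_pre_digraph \<Rightarrow> ('b \<Rightarrow> 'a) \<Rightarrow> bool" where
  "partial_copy T r H S f \<longleftrightarrow> H \<subseteq> pverts T \<and> inj_on f H \<and> f ` H \<subseteq> pverts S \<and>
     (\<forall>x \<in> H. \<forall>y \<in> H. (f x, f y) \<in> parcs S \<longleftrightarrow> (x, y) \<in> parcs T) \<and>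
     (\<forall>x \<in> H - {r}. nbhd S (f x) \<subseteq> f ` H)"

lemma partial_copy_nbhd:
  assumes "partial_copy T r H S f" "x \<in> H" "x \<noteq> r"
  shows "nbhd S (f x) = f ` (nbhd T x \<inter> H)"
proof
  have "nbhd S (f x) \<subseteq> f ` H" "\<And>y. y \<in> H \<Longrightarrow> (f x, f y) \<in> parcs S \<longleftrightarrow> (x, y) \<in> parcs T"
    using assms unfolding partial_copy_def by blast+
  then show "nbhd S (f x) \<subseteq> f ` (nbhd T x \<inter> H)" "f ` (nbhd T x \<inter> H) \<subseteq> nbhd S (f x)"
    unfolding nbhd_def by blast+
qed

lemma partial_copy_leaf:
  assumes copy: "partial_copy T r H S f" and x: "x \<in> H" "x \<noteq> r" "nbhd T x \<inter> H = {y}"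
  shows "leaf S (f x)"
proof -
  have "nbhd S (f x) = {f y}"
    using partial_copy_nbhd[OF copy x(1,2)] x(3) by simp
  moreover have "f x \<in> pverts S"
    using copy x(1) unfolding partial_copy_def by blast
  ultimately show ?thesis
    by (simp add: leaf_def)
qed

lemma partial_copy_insert:
  assumes T: "pair_graph T" and copy: "partial_copy T r H S f" and r: "r \<in> H"
    and c: "c \<in> pverts T" "c \<notin> H" "nbhd T c \<inter> H = {u}" and b: "b \<in> pverts S" "b \<notin> f ` H"
  shows "partial_copy T r (insert c H) (attach_vertex (delete_vertex S b) (f u) b) (f(c := b))"
    (is "partial_copy T r _ ?S ?f")
proof -
  have u: "u \<in> H"
    using c(3) by blast
  have f: "H \<subseteq> pverts T" "inj_on f H" "f ` H \<subseteq> pverts S"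
    "\<And>x y. x \<in> H \<Longrightarrow> y \<in> H \<Longrightarrow> (f x, f y) \<in> parcs S \<longleftrightarrow> (x, y) \<in> parcs T"
    "\<And>x. x \<in> H \<Longrightarrow> x \<noteq> r \<Longrightarrow> nbhd S (f x) \<subseteq> f ` H"
    using copy unfolding partial_copy_def by blast+
  have fH: "f x \<noteq> b" "?f x = f x" "x \<noteq> c" if "x \<in> H" for x
    using that b(2) c(2) by auto
  have fb: "?f c = b"
    by simp
  have inj: "f x = f u \<longleftrightarrow> x = u" if "x \<in> H" for x
    using f(2) that u by (auto dest: inj_onD)
  have cH: "(c, x) \<in> parcs T \<longleftrightarrow> x = u" "(x, c) \<in> parcs T \<longleftrightarrow> x = u" if "x \<in> H" for x
    using c(3) that T unfolding nbhd_def pair_graph_iff sym_def by blast+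
  have arcs: "(p, q) \<in> parcs ?S \<longleftrightarrow>
      (p, q) \<in> parcs S \<and> p \<noteq> b \<and> q \<noteq> b \<or> p = f u \<and> q = b \<or> p = b \<and> q = f u" for p q
    by (auto simp: attach_vertex_def delete_vertex_def)
  have edge: "(?f x, ?f y) \<in> parcs ?S \<longleftrightarrow> (x, y) \<in> parcs T" if xy: "x \<in> insert c H" "y \<in> insert c H" for x y
  proof -
    consider "x \<in> H" "y \<in> H" | "x \<in> H" "y = c" | "x = c" "y \<in> H" | "x = c" "y = c"
      using xy by blast
    then show ?thesis
    proof cases
      case 1
      then show ?thesis
        using f(4) fH unfolding arcs by metis
    next
      case 2
      then show ?thesis
        using inj cH fH fb unfolding arcs by metis
    next
      case 3
      then show ?thesis
        using inj cH fH fb unfolding arcs by metis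
    next
      case 4
      then show ?thesis
        using T fH(1)[OF u] unfolding arcs by (auto simp: pair_graph_iff)
    qed
  qed
  have img: "?f ` insert c H = insert b (f ` H)"
    using c(2) by auto
  have nb: "nbhd ?S (?f x) \<subseteq> ?f ` insert c H" if x: "x \<in> insert c H - {r}" for x
  proof (cases "x = c")
    case True
    then show ?thesis
      using u fH(1)[OF u] unfolding img by (auto simp: nbhd_def arcs)
  next
    case False
    then have "nbhd ?S (?f x) \<subseteq> insert b (nbhd S (f x))"
      using x fH(1)[of x] by (auto simp: nbhd_def arcs)
    then show ?thesis
      using f(5)[of x] False x unfolding img by blast
  qed
  have "inj_on ?f (insert c H)"
    using f(2) b(2) c(2) by (auto simp: inj_on_def)
  moreover have "?f ` insert c H \<subseteq> pverts ?S"
    using f(3) unfolding img by (auto simp: attach_vertex_def delete_vertex_def)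
  ultimately show ?thesis
    unfolding partial_copy_def using f(1) c(1) edge nb by (intro conjI ballI) simp_all
qed

text \<open>
  By cardinality, a copy of all of \<open>T\<close> leaves no unused vertex in \<open>S\<close>.
\<close>

lemma full_copy_iso:
  assumes T: "pair_graph T" and S: "pair_graph S" and copy: "partial_copy T r (pverts T) S f"
    and card: "card (pverts S) = card (pverts T)"
  shows "digraph_iso (with_proj S) (with_proj T)"
proof -
  interpret T: pair_graph T by fact
  interpret S: pair_graph S by fact
  have f: "inj_on f (pverts T)" "f ` pverts T \<subseteq> pverts S"
    "\<And>x y. x \<in> pverts T \<Longrightarrow> y \<in> pverts T \<Longrightarrow> (f x, f y) \<in> parcs S \<longleftrightarrow> (x, y) \<in> parcs T"
    using copy unfolding partial_copy_def by blast+
  have verts: "f ` pverts T = pverts S"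
    using f card S.pair_finite_verts by (intro card_subset_eq) (auto simp: card_image)
  have arcs: "map_prod f f ` parcs T = parcs S"
  proof
    show "map_prod f f ` parcs T \<subseteq> parcs S"
      using f(3) T.in_arcsD1 T.in_arcsD2 by auto
    show "parcs S \<subseteq> map_prod f f ` parcs T"
    proof
      fix e
      assume e: "e \<in> parcs S"
      then obtain x y where "e = (f x, f y)" "x \<in> pverts T" "y \<in> pverts T"
        using S.arc_fst_in_verts S.arc_snd_in_verts verts by (metis imageE prod.collapse)
      then show "e \<in> map_prod f f ` parcs T"
        using f(3) e by force
    qed
  qed
  let ?h = "\<lparr>iso_verts = f, iso_arcs = map_prod f f, iso_head = snd, iso_tail = fst\<rparr>"
  have "inj_on (map_prod f f) (parcs T)"
    by (rule inj_on_subset[OF map_prod_inj_on[OF f(1) f(1)]])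
      (use T.in_arcsD1 T.in_arcsD2 in auto)
  then have "pre_digraph.digraph_isomorphism (with_proj T) ?h"
    using f(1) T.wf_digraph_axioms unfolding pre_digraph.digraph_isomorphism_def by auto
  moreover have "with_proj S = app_iso ?h (with_proj T)"
    using verts arcs by (simp add: app_iso_def with_proj_def)
  ultimately have "digraph_iso (with_proj T) (with_proj S)"
    unfolding digraph_iso_def by blast
  then show ?thesis
    using digraph_iso_swap T.wf_digraph_axioms by blast
qed

section \<open>Stretching and expanding as moves of a leaf\<close>

lemma finite_enumeration_from:
  assumes "finite X" "p \<in> X"
  obtains z :: "nat \<Rightarrow> 'a" where "inj_on z {..<card X}" "z ` {..<card X} = X" "z 0 = p"
proof -
  obtain xs where xs: "set xs = X - {p}" "distinct xs"
    using finite_distinct_list assms(1) by blast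
  then have ps: "distinct (p # xs)" "set (p # xs) = X"
    using assms(2) by auto
  then have len: "card X = length (p # xs)"
    using distinct_card by metis
  have "inj_on ((!) (p # xs)) {..<card X}" "(!) (p # xs) ` {..<card X} = X"
    unfolding len using ps inj_on_nth[OF ps(1)] set_conv_nth[of "p # xs"] by auto
  then show ?thesis
    using that by simp
qed

lemma move_leaf_tree:
  assumes "undirected_tree S" "leaf S b" "a \<in> pverts S" "a \<noteq> b"
  shows "undirected_tree (attach_vertex (delete_vertex S b) a b)"
  using assms by (intro tree_attach_vertex tree_delete_leaf) (auto simp: delete_vertex_def)

lemma pverts_move_leaf:
  "b \<in> pverts S \<Longrightarrow> pverts (attach_vertex (delete_vertex S b) a b) = pverts S"
  by (auto simp: attach_vertex_def delete_vertex_def)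

text \<open>
  The vertex added by an operation may carry the name of the deleted one. With this choice
  the vertex set never changes, and an operation just moves the leaf \<open>b\<close> to a new neighbor.
\<close>

lemma stretch_move_leaf:
  assumes "undirected_tree S" "3 \<le> card (pverts S)" "leaf S a" "leaf S b" "b \<noteq> a"
  shows "stretch_or_expand S (attach_vertex (delete_vertex S b) a b)"
proof -
  have "b \<notin> pverts (delete_vertex S b)"
    by (simp add: delete_vertex_def)
  then show ?thesis
    using assms unfolding stretch_or_expand_def stretching_at_def by blast
qed

text \<open>
  The bounds on the degree \<open>d\<close> in the expanding operation come for free: \<open>u\<close> has a second
  neighbor besides \<open>p\<close>, and its neighborhood misses both \<open>u\<close> itself and \<open>b\<close>.
\<close>

lemma expand_move_leaf:
  assumes S: "undirected_tree S" and u: "u \<in> pverts S"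
    and p: "p \<in> nbhd S u" "\<not> leaf S p" "nbhd S u \<noteq> {p}"
    and leaves: "\<And>x. x \<in> nbhd S u \<Longrightarrow> x \<noteq> p \<Longrightarrow> leaf S x"
    and b: "leaf S b" "b \<notin> closed_nbhd S u"
  shows "stretch_or_expand S (attach_vertex (delete_vertex S b) u b)"
proof -
  have G: "pair_graph S"
    using S by (simp add: undirected_tree_def)
  then have fin: "finite (pverts S)"
    by (simp add: pair_graph_iff)
  have "b \<in> pverts S" "b \<noteq> u"
    using b by (auto simp: leaf_def closed_nbhd_def)
  have sub: "nbhd S u \<subseteq> pverts S - {u, b}"
    using b(2) G by (auto simp: nbhd_def closed_nbhd_def pair_graph_iff)
  then have finN: "finite (nbhd S u)"
    using fin finite_subset by blast
  have "card {u, b} \<le> card (pverts S)" "card {u, b} = 2"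
    using card_mono[OF fin, of "{u, b}"] u \<open>b \<in> pverts S\<close> \<open>b \<noteq> u\<close> by simp_all
  moreover have "card (pverts S - {u, b}) = card (pverts S) - card {u, b}"
    using u \<open>b \<in> pverts S\<close> by (intro card_Diff_subset) auto
  ultimately have le: "card (nbhd S u) \<le> card (pverts S) - 2"
    using card_mono[OF _ sub] fin by simp
  have "card (nbhd S u) \<noteq> 0" "card (nbhd S u) \<noteq> 1"
    using p(1,3) finN by (auto simp: card_1_singleton_iff)
  then have ge: "2 \<le> card (nbhd S u)"
    by linarith
  obtain z where z: "inj_on z {..<card (nbhd S u)}" "z ` {..<card (nbhd S u)} = nbhd S u" "z 0 = p"
    using finite_enumeration_from[OF finN p(1)] .
  have zleaf: "leaf S (z i)" if i: "1 \<le> i" "i \<le> card (nbhd S u) - 1" for i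
  proof (rule leaves)
    have "i < card (nbhd S u)" "0 < card (nbhd S u)" "i \<noteq> 0"
      using i ge by linarith+
    then show "z i \<in> nbhd S u" "z i \<noteq> p"
      using z inj_onD[OF z(1), of i 0] by auto
  qed
  have "\<exists>d z. 2 \<le> d \<and> d \<le> card (pverts S) - 2 \<and> inj_on z {..<d} \<and> nbhd S u = z ` {..<d} \<and>
        (\<forall>i. 1 \<le> i \<and> i \<le> d - 1 \<longrightarrow> leaf S (z i)) \<and> \<not> leaf S (z 0)"
    by (rule exI[of _ "card (nbhd S u)"], rule exI[of _ z]) (use z p(2) le ge zleaf in simp)
  moreover have "4 \<le> card (pverts S)"
    using le ge by linarith
  moreover have "b \<notin> pverts (delete_vertex S b)"
    by (simp add: delete_vertex_def)
  ultimately show ?thesis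
    using S u b unfolding stretch_or_expand_def expanding_at_def by blast
qed

section \<open>Growing the copy level by level\<close>

text \<open>
  The parts of the target tree that occur when its vertices are added level by level.
\<close>

definition initial_segment :: "'b pair_pre_digraph \<Rightarrow> ('b \<Rightarrow> nat) \<Rightarrow> 'b set \<Rightarrow> bool" where
  "initial_segment T d H \<longleftrightarrow> (\<forall>x \<in> H. \<forall>y \<in> pverts T. d y < d x \<longrightarrow> y \<in> H)"

text \<open>
  The vertex \<open>c\<close> to add next is one of lowest level outside \<open>H\<close>. Its parent \<open>u\<close> is in \<open>H\<close>, and \<open>u\<close> is not the
  root, because all neighbors of the root are present from the start. The unused part of \<open>S\<close> is nonempty
  and hangs from the root, so it contains a leaf \<open>b\<close>, which is moved to \<open>f u\<close>. If \<open>u\<close> has no child in \<open>H\<close> yet,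
  then \<open>f u\<close> is a leaf and the move is a stretching. Otherwise it is an expanding: since vertices are
  added level by level, nothing in \<open>H\<close> lies above the level of \<open>c\<close>, so the children of \<open>u\<close> in \<open>H\<close> are leaves. The
  image of the parent \<open>p\<close> of \<open>u\<close> is not a leaf: it has a parent of its own or, if \<open>p\<close> is the root, a neighbor
  in the unused part.
\<close>

lemma grow_copy:
  fixes S :: "'a pair_pre_digraph" and T :: "'b pair_pre_digraph"
  assumes S: "undirected_tree S" and T: "pair_graph T" and d: "levelling T r d"
    and card: "card (pverts S) = card (pverts T)"
    and copy: "partial_copy T r H S f" and init: "initial_segment T d H"
    and rs: "r \<in> H" "nbhd T r \<subseteq> H" and H: "H \<noteq> pverts T"
  obtains c S' f' where "c \<in> pverts T" "c \<notin> H" "initial_segment T d (insert c H)"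
    "partial_copy T r (insert c H) S' f'" "undirected_tree S'" "card (pverts S') = card (pverts T)"
    "stretch_or_expand S S'"
proof -
  have G: "pair_graph S"
    using S by (simp add: undirected_tree_def)
  have fin: "finite (pverts S)" "finite (pverts T)"
    using G T by (simp_all add: pair_graph_iff)
  have HT: "H \<subseteq> pverts T" and inj: "inj_on f H" and HS: "f ` H \<subseteq> pverts S"
    and f: "\<And>x y. x \<in> H \<Longrightarrow> y \<in> H \<Longrightarrow> (f x, f y) \<in> parcs S \<longleftrightarrow> (x, y) \<in> parcs T"
    using copy unfolding partial_copy_def by blast+
  have symT: "(y, x) \<in> parcs T" if "(x, y) \<in> parcs T" for x y
    using T that unfolding pair_graph_iff sym_def by blast
  have symS: "(y, x) \<in> parcs S" if "(x, y) \<in> parcs S" for x y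
    using G that unfolding pair_graph_iff sym_def by blast
  have parent: "\<exists>q \<in> pverts T. (x, q) \<in> parcs T \<and> d x = Suc (d q)" if "x \<in> pverts T" "x \<noteq> r" for x
    using d T that unfolding levelling_def pair_graph_iff by blast
  have down: "y \<in> H" if "x \<in> H" "y \<in> pverts T" "d y < d x" for x y
    using init that unfolding initial_segment_def by blast
  have "pverts T - H \<noteq> {}"
    using H HT by blast
  then obtain c where c: "c \<in> pverts T" "c \<notin> H" and min: "\<And>x. x \<in> pverts T \<Longrightarrow> x \<notin> H \<Longrightarrow> d c \<le> d x"
    using ex_min_if_finite[of "d ` (pverts T - H)"] fin by (auto simp: not_less)
  have below_c: "d x \<le> d c" if "x \<in> H" for x
    using down[OF that c(1)] c(2) by (meson not_le)
  obtain u where u: "u \<in> pverts T" "(c, u) \<in> parcs T" "d c = Suc (d u)"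
    using parent[of c] c rs by blast
  have "u \<in> H"
    using min[OF u(1)] u(3) by linarith
  have cu: "nbhd T c \<inter> H = {u}"
  proof -
    have "x = u" if "x \<in> H" "(c, x) \<in> parcs T" for x
      using levelling_lower_unique[OF T d that(2) u(2) below_c[OF that(1)]] u(3) by simp
    then show ?thesis
      using u(2) \<open>u \<in> H\<close> unfolding nbhd_def by blast
  qed
  have "u \<noteq> r"
    using rs c symT[OF u(2)] unfolding nbhd_def by blast
  obtain p where p: "p \<in> pverts T" "(u, p) \<in> parcs T" "d u = Suc (d p)"
    using parent[OF u(1) \<open>u \<noteq> r\<close>] by blast
  have "p \<in> H"
    using down[OF \<open>u \<in> H\<close> p(1)] p(3) by linarith
  define R where "R = pverts S - f ` H"
  have "f ` H \<noteq> pverts S"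
    using card card_image[OF inj] psubset_card_mono[OF fin(2) psubsetI[OF HT H]] by auto
  then have R: "R \<subseteq> pverts S" "R \<noteq> {}" "f r \<notin> R"
    using HS rs(1) unfolding R_def by blast+
  have closed: "nbhd S v \<subseteq> insert (f r) R" if v: "v \<in> R" for v
  proof
    fix x
    assume "x \<in> nbhd S v"
    then have x: "(x, v) \<in> parcs S" "x \<in> pverts S"
      using symS G unfolding nbhd_def pair_graph_iff by blast+
    have "v \<in> f ` H" if "x = f y" "y \<in> H" "y \<noteq> r" for y
      using copy x(1) that unfolding partial_copy_def nbhd_def by blast
    then show "x \<in> insert (f r) R"
      using x(2) v unfolding R_def by blast
  qed
  obtain e where e: "levelling S (f r) e"
    using tree_levelling[OF S] HS rs(1) by blast
  obtain b where b: "b \<in> R" "leaf S b"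
    using leaf_in_branch[OF G e R closed] by blast
  have bS: "b \<in> pverts S" "b \<notin> f ` H"
    using b(1) by (auto simp: R_def)
  have "f u \<noteq> b" "f u \<in> pverts S"
    using bS(2) HS \<open>u \<in> H\<close> by blast+
  define S' where "S' = attach_vertex (delete_vertex S b) (f u) b"
  have nbu: "nbhd S (f u) = f ` (nbhd T u \<inter> H)"
    by (rule partial_copy_nbhd[OF copy \<open>u \<in> H\<close> \<open>u \<noteq> r\<close>])
  have "p \<in> nbhd T u \<inter> H"
    using p(2) \<open>p \<in> H\<close> by (simp add: nbhd_def)
  have "stretch_or_expand S S'"
  proof (cases "nbhd T u \<inter> H = {p}")
    case True
    have "f r \<noteq> f u"
      using inj rs(1) \<open>u \<in> H\<close> \<open>u \<noteq> r\<close> by (auto dest: inj_onD)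
    moreover have "f r \<noteq> b"
      using bS(2) rs(1) by blast
    ultimately have "card {f r, f u, b} = 3"
      using \<open>f u \<noteq> b\<close> by simp
    moreover have "{f r, f u, b} \<subseteq> pverts S"
      using HS rs(1) \<open>u \<in> H\<close> bS(1) by blast
    ultimately have "3 \<le> card (pverts S)"
      using card_mono[OF fin(1)] by metis
    then show ?thesis
      unfolding S'_def
      using partial_copy_leaf[OF copy \<open>u \<in> H\<close> \<open>u \<noteq> r\<close> True] b(2) \<open>f u \<noteq> b\<close>
      by (intro stretch_move_leaf[OF S]) auto
  next
    case False
    show ?thesis
      unfolding S'_def
    proof (rule expand_move_leaf[OF S \<open>f u \<in> pverts S\<close> _ _ _ _ b(2)])
      show "f p \<in> nbhd S (f u)"
        unfolding nbu using \<open>p \<in> nbhd T u \<inter> H\<close> by (rule imageI)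
      obtain y where "y \<in> nbhd T u \<inter> H" "y \<noteq> p"
        using False \<open>p \<in> nbhd T u \<inter> H\<close> by blast
      moreover from this have "f y \<noteq> f p"
        using inj \<open>p \<in> H\<close> by (auto dest: inj_onD)
      ultimately show "nbhd S (f u) \<noteq> {f p}"
        unfolding nbu by blast
      show "b \<notin> closed_nbhd S (f u)"
        using bS(2) \<open>f u \<noteq> b\<close> unfolding closed_nbhd_def nbu by blast
      show "leaf S x" if x: "x \<in> nbhd S (f u)" "x \<noteq> f p" for x
      proof -
        obtain w where w: "x = f w" "w \<in> H" "(u, w) \<in> parcs T" "w \<noteq> p"
          using x unfolding nbu by (auto simp: nbhd_def)
        have "\<not> d w \<le> d u"
          using levelling_lower_unique[OF T d w(3) p(2)] p(3) w(4) by linarith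
        then have "d w = d c"
          using below_c[OF w(2)] u(3) by linarith
        have "y = u" if "y \<in> H" "(w, y) \<in> parcs T" for y
          using levelling_lower_unique[OF T d that(2) symT[OF w(3)]] below_c[OF that(1)]
            \<open>d w = d c\<close> u(3) by linarith
        then have "nbhd T w \<inter> H = {u}"
          using symT[OF w(3)] \<open>u \<in> H\<close> unfolding nbhd_def by blast
        moreover have "w \<noteq> r"
          using \<open>d w = d c\<close> u(3) d by (auto simp: levelling_def)
        ultimately show ?thesis
          unfolding w(1) by (intro partial_copy_leaf[OF copy w(2)])
      qed
      have "(f p, f u) \<in> parcs S"
        using f[OF \<open>p \<in> H\<close> \<open>u \<in> H\<close>] symT[OF p(2)] by blast
      show "\<not> leaf S (f p)"
      proof (cases "p = r")
        case True
        obtain v where "v \<in> R" "(v, f r) \<in> parcs S"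
          using branch_meets_root[OF e R closed] by blast
        then show ?thesis
          using \<open>(f p, f u) \<in> parcs S\<close> symS \<open>u \<in> H\<close> True unfolding R_def by (intro not_leafI[of "f p" v _ "f u"]) auto
      next
        case False
        then obtain q where q: "q \<in> pverts T" "(p, q) \<in> parcs T" "d p = Suc (d q)"
          using parent[OF p(1)] by blast
        have "q \<in> H"
          using down[OF \<open>p \<in> H\<close> q(1)] q(3) by linarith
        moreover have "q \<noteq> u"
          using q(3) p(3) by auto
        ultimately have "f q \<noteq> f u"
          using inj \<open>u \<in> H\<close> by (auto dest: inj_onD)
        then show ?thesis
          using not_leafI[OF _ \<open>(f p, f u) \<in> parcs S\<close>] f[OF \<open>p \<in> H\<close> \<open>q \<in> H\<close>] q(2) by blast
      qed
    qed
  qed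
  moreover have "undirected_tree S'"
    unfolding S'_def using move_leaf_tree[OF S b(2)] \<open>f u \<in> pverts S\<close> \<open>f u \<noteq> b\<close> .
  moreover have "card (pverts S') = card (pverts T)"
    unfolding S'_def pverts_move_leaf[OF bS(1)] by (rule card)
  moreover have "partial_copy T r (insert c H) S' (f(c := b))"
    unfolding S'_def by (rule partial_copy_insert[OF T copy rs(1) c cu bS])
  moreover have "initial_segment T d (insert c H)"
    using down min unfolding initial_segment_def by (metis insert_iff not_less)
  ultimately show ?thesis
    using c that by blast
qed

lemma complete_copy:
  fixes S :: "'a pair_pre_digraph" and T :: "'b pair_pre_digraph"
  assumes T: "pair_graph T" and d: "levelling T r d" and rs: "r \<in> H" "nbhd T r \<subseteq> H"
    and S: "undirected_tree S" "card (pverts S) = card (pverts T)"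
    and copy: "partial_copy T r H S f" and init: "initial_segment T d H"
  shows "\<exists>S' f'. stretch_or_expand\<^sup>*\<^sup>* S S' \<and> undirected_tree S' \<and> card (pverts S') = card (pverts T) \<and>
    partial_copy T r (pverts T) S' f'"
  using rs S copy init
proof (induction "card (pverts T - H)" arbitrary: H S f rule: less_induct)
  case less
  show ?case
  proof (cases "H = pverts T")
    case True
    then show ?thesis
      using less.prems by blast
  next
    case False
    obtain c S1 f1 where c: "c \<in> pverts T" "c \<notin> H" and init: "initial_segment T d (insert c H)"
      and copy: "partial_copy T r (insert c H) S1 f1"
      and S1: "undirected_tree S1" "card (pverts S1) = card (pverts T)" "stretch_or_expand S S1"
      using grow_copy[OF less.prems(3) T d less.prems(4,5,6,1,2) False] .
    have "finite (pverts T)"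
      using T by (simp add: pair_graph_iff)
    then have "card (pverts T - insert c H) < card (pverts T - H)"
      using c by (intro psubset_card_mono) auto
    then obtain S' f' where "stretch_or_expand\<^sup>*\<^sup>* S1 S'" "undirected_tree S'"
      "card (pverts S') = card (pverts T)" "partial_copy T r (pverts T) S' f'"
      using less.hyps[OF _ _ _ S1(1,2) copy init] less.prems(1,2) by blast
    then show ?thesis
      using S1(3) by (blast intro: converse_rtranclp_into_rtranclp)
  qed
qed

theorem proposition1p4:
  fixes T :: "'a pair_pre_digraph" and T' :: "'b pair_pre_digraph" and n :: nat
  assumes "undirected_tree T" and "card (pverts T) = n"
    and "undirected_tree T'" and "card (pverts T') = n"
  shows "\<exists>S. stretch_or_expand\<^sup>*\<^sup>* T S \<and> digraph_iso (with_proj S) (with_proj T')"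
proof -
  have G: "pair_graph T" "pair_graph T'"
    using assms by (simp_all add: undirected_tree_def)
  show ?thesis
  proof (cases "2 \<le> n")
    case True
    obtain a where "leaf T a"
      using tree_has_leaf[OF assms(1)] assms(2) True by blast
    then obtain c where c: "nbhd T a = {c}" "a \<in> pverts T"
      using leafE by (metis leaf_def)
    obtain r where "leaf T' r"
      using tree_has_leaf[OF assms(3)] assms(4) True by blast
    then obtain s where s: "nbhd T' r = {s}" "r \<in> pverts T'"
      using leafE by (metis leaf_def)
    obtain d where d: "levelling T' r d"
      using tree_levelling[OF assms(3) s(2)] .
    have ac: "(a, c) \<in> parcs T" "(c, a) \<in> parcs T" "c \<in> pverts T" "a \<noteq> c"
      using c(1) G(1) unfolding nbhd_def pair_graph_iff sym_def by blast+
    have rs: "(r, s) \<in> parcs T'" "(s, r) \<in> parcs T'" "s \<in> pverts T'" "r \<noteq> s"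
      using s(1) G(2) unfolding nbhd_def pair_graph_iff sym_def by blast+
    have loops: "(x, x) \<notin> parcs T" "(y, y) \<notin> parcs T'" for x y
      using G by (auto simp: pair_graph_iff)
    \<comment> \<open>the root is sent to \<open>c\<close> and not to the leaf \<open>a\<close>, so that everything else in \<open>T\<close> hangs from its image\<close>
    have copy: "partial_copy T' r {r, s} T ((\<lambda>_. a)(r := c))"
      using ac rs loops c s unfolding partial_copy_def by simp
    have init: "initial_segment T' d {r, s}"
    proof -
      have "d r = 0"
        using d by (simp add: levelling_def)
      moreover have "d s = Suc (d r) \<or> d r = Suc (d s)"
        using d rs(1) unfolding levelling_def by blast
      ultimately have "d s = 1"
        by simp
      have "y = r" if "y \<in> pverts T'" "d y = 0" for y
        using d that unfolding levelling_def by (metis DiffI nat.distinct(1) singletonD)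
      then show ?thesis
        using \<open>d s = 1\<close> \<open>d r = 0\<close> by (simp add: initial_segment_def)
    qed
    obtain S f where S: "stretch_or_expand\<^sup>*\<^sup>* T S" "undirected_tree S"
      "card (pverts S) = card (pverts T')" "partial_copy T' r (pverts T') S f"
      using complete_copy[OF G(2) d _ _ assms(1) _ copy init] s(1) assms(2,4) by auto
    moreover from S(2) have "pair_graph S"
      by (simp add: undirected_tree_def)
    ultimately show ?thesis
      using full_copy_iso[OF G(2)] by blast
  next
    case False
    have "pverts T \<noteq> {}" "pverts T' \<noteq> {}"
      using assms(1,3) unfolding undirected_tree_def Digraph_Component.connected_def strongly_connected_def
      by simp_all
    then have "card (pverts T) = 1" "card (pverts T') = 1"
      using False assms(2,4) G card_0_eq[of "pverts T"] card_0_eq[of "pverts T'"]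
      by (auto simp: pair_graph_iff)
    then obtain x y where xy: "pverts T = {x}" "pverts T' = {y}"
      by (metis card_1_singletonE)
    have "parcs T \<subseteq> {(x, x)}" "(x, x) \<notin> parcs T" "parcs T' \<subseteq> {(y, y)}" "(y, y) \<notin> parcs T'"
      using G xy unfolding pair_graph_iff by simp_all
    then have "parcs T = {}" "parcs T' = {}"
      by blast+
    then have "partial_copy T' y (pverts T') T (\<lambda>_. x)"
      using xy by (simp add: partial_copy_def)
    then have "digraph_iso (with_proj T) (with_proj T')"
      using full_copy_iso[OF G(2,1)] assms(2,4) by simp
    then show ?thesis
      by blast
  qed
qed

end
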